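(* Let $\mathbb{F}$ be an algebraically closed field of characteristic $p\ge0$ and let $A$ be a finite dimensional (not necessarily unital) associative algebra over $\mathbb{F}$. Suppose that either $A$ is $4$-perfect, or $A$ is $1$-perfect and $p\neq 2$. Then the Lie algebra $A^{(1)}$ is perfect and $A=A^{(1)}A^{(1)}+A^{(1)}$.
   Context: $A^{(1)}=[A,A]$ is the linear span of all commutators $[x,y]=xy-yx$, $x,y\in A$, i.e. the derived subalgebra of $A$ viewed as a Lie algebra under the commutator bracket. $A^{(1)}A^{(1)}$ is the linear span of all associative products $xy$ with $x,y\in A^{(1)}$. A Lie algebra $L$ is perfect if $[L,L]=L$. An associative algebra is $k$-perfect ($k\ge1$) if it has no proper (i.e. $\neq A$) two-sided ideals of codimension $\le k$. *)

theory Defs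
  imports
    "HOL-Computational_Algebra.Computational_Algebra"
    "HOL-Library.Set_Algebras"
begin

text \<open>
  The algebra is the whole type \<open>'a\<close>, which is only a \<open>ring\<close>: no unit is required, and the
  zero algebra is allowed.
\<close>

locale associative_algebra = vector_space scale
  for scale :: "'k::field \<Rightarrow> 'a::ring \<Rightarrow> 'a" +
  assumes scale_mult_left: "scale c x * y = scale c (x * y)"
    and scale_mult_right: "x * scale c y = scale c (x * y)"
begin

definition commutator :: "'a \<Rightarrow> 'a \<Rightarrow> 'a" where
  "commutator x y = x * y - y * x"

definition lie_product :: "'a set \<Rightarrow> 'a set \<Rightarrow> 'a set" where
  "lie_product U V = span {commutator x y | x y. x \<in> U \<and> y \<in> V}"

definition assoc_product :: "'a set \<Rightarrow> 'a set \<Rightarrow> 'a set" where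
  "assoc_product U V = span {x * y | x y. x \<in> U \<and> y \<in> V}"

definition derived :: "'a set" where
  "derived = lie_product UNIV UNIV"

definition lie_subalgebra :: "'a set \<Rightarrow> bool" where
  "lie_subalgebra L \<longleftrightarrow> subspace L \<and> (\<forall>x\<in>L. \<forall>y\<in>L. commutator x y \<in> L)"

definition lie_perfect :: "'a set \<Rightarrow> bool" where
  "lie_perfect L \<longleftrightarrow> lie_subalgebra L \<and> lie_product L L = L"

definition two_sided_ideal :: "'a set \<Rightarrow> bool" where
  "two_sided_ideal I \<longleftrightarrow> subspace I \<and> (\<forall>a. \<forall>x\<in>I. a * x \<in> I \<and> x * a \<in> I)"

lemma lie_subalgebra_derived: "lie_subalgebra derived"
  unfolding lie_subalgebra_def derived_def lie_product_def
  by (auto intro: span_base)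

end

text \<open>
  The parameter \<open>Basis\<close> is the finite basis that the library locale uses to express finite
  dimension; no definition below depends on it.
\<close>

locale finite_dimensional_algebra =
  associative_algebra scale + finite_dimensional_vector_space scale Basis
  for scale :: "'k::field \<Rightarrow> 'a::ring \<Rightarrow> 'a" and Basis :: "'a set"
begin

definition codim :: "'a set \<Rightarrow> nat" where
  "codim I = dim UNIV - dim I"

definition k_perfect :: "nat \<Rightarrow> bool" where
  "k_perfect k \<longleftrightarrow> \<not> (\<exists>I. two_sided_ideal I \<and> I \<noteq> UNIV \<and> codim I \<le> k)"

end

end

theory Submission
  imports Defs
begin

text \<open>
  Herstein's argument: for a Lie ideal \<open>U\<close> of \<open>A\<close>, the two-sided ideal generated by \<open>[U, U]\<close> is
  contained in \<open>U U + U\<close>. Put \<open>L = [A, A]\<close> and \<open>D = [L, L]\<close>. If the ideal generated by \<open>[D, D]\<close> is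
  \<open>A\<close>, then \<open>A = D D + D\<close>, and \<open>[a, u v] = [a u, v] + [v a, u]\<close> gives \<open>L = [A, D D + D] \<subseteq> D\<close>.
  Otherwise \<open>[D, D]\<close> lies in a maximal left ideal \<open>J\<close>. By the density theorem for the simple module
  \<open>A / J\<close>, perfectness forces \<open>dim (A / J) \<ge> 2\<close>, respectively \<open>dim (A / J) \<ge> 3\<close>, and \<open>A\<close> contains
  elements acting on two, respectively three, independent vectors as \<open>e, f, h\<close> of \<open>sl\<^sub>2\<close>, respectively
  as the root vectors of \<open>sl\<^sub>3\<close>. Such elements survive passing to \<open>[U, U]\<close>, so \<open>[D, D]\<close> does not
  annihilate \<open>A / J\<close>, a contradiction.
\<close>

section \<open>Linear relations and dimension bounds\<close>

context finite_dimensional_vector_space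
begin

text \<open>One vector more than the dimension forces a relation. Its coefficients are packed into a
  polynomial because \<open>s\<close> will later be a sequence of iterates of an endomorphism, so
  that the relation can be factored at a root.\<close>

lemma exists_linear_relation:
  fixes s :: "nat \<Rightarrow> 'b"
  obtains p :: "'a poly" where "p \<noteq> 0" "degree p \<le> dimension"
    "(\<Sum>i\<le>dimension. scale (coeff p i) (s i)) = 0"
proof (cases "inj_on s {..dimension}")
  case False
  then obtain i j where ij: "i \<le> dimension" "j \<le> dimension" "i \<noteq> j" "s i = s j"
    by (auto simp: inj_on_def)
  let ?p = "monom 1 i - monom (1::'a) j"
  have "coeff ?p i \<noteq> coeff 0 i" using ij by simp
  then have "?p \<noteq> 0" by metis
  moreover have "degree ?p \<le> dimension"
    using ij by (intro degree_diff_le) (simp_all add: degree_monom_eq)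
  moreover have "(\<Sum>l\<le>dimension. scale (coeff ?p l) (s l)) =
      (\<Sum>l\<le>dimension. if l = i then s i else 0) - (\<Sum>l\<le>dimension. if l = j then s j else 0)"
    unfolding sum_subtractf[symmetric] using ij by (intro sum.cong) auto
  then have "(\<Sum>l\<le>dimension. scale (coeff ?p l) (s l)) = 0" using ij by simp
  ultimately show ?thesis by (rule that)
next
  case True
  then have "card (s ` {..dimension}) = Suc dimension" by (simp add: card_image)
  then have "dependent (s ` {..dimension})"
    using dim_subset_UNIV[of "s ` {..dimension}"] by (intro dependent_biggerset_general) simp
  then obtain u where u: "\<exists>v\<in>s ` {..dimension}. u v \<noteq> 0"
      and sum0: "(\<Sum>v\<in>s ` {..dimension}. scale (u v) v) = 0"
    by (auto simp: dependent_finite)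
  define p where "p = (\<Sum>i\<le>dimension. monom (u (s i)) i)"
  have coeff: "coeff p i = (if i \<le> dimension then u (s i) else 0)" for i
    by (simp add: p_def coeff_sum)
  have "p \<noteq> 0" using u coeff by (metis (no_types, lifting) atMost_iff coeff_0 imageE)
  moreover have "degree p \<le> dimension" by (rule degree_le) (simp add: coeff)
  moreover have "(\<Sum>i\<le>dimension. scale (coeff p i) (s i)) = 0"
    using sum0 True by (simp add: sum.reindex coeff)
  ultimately show ?thesis by (rule that)
qed

lemma dim_Un_le: "finite E \<Longrightarrow> dim (E \<union> M) \<le> card E + dim M"
  by (induction E rule: finite_induct) (auto simp: dim_insert)

end

section \<open>Lie ideals and Herstein's argument\<close>

context associative_algebra
begin

lemma scale_linear_left_mult: "module_hom scale scale (\<lambda>x. a * x)"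
  by unfold_locales (simp_all add: distrib_left scale_mult_right)

lemma scale_linear_right_mult: "module_hom scale scale (\<lambda>x. x * a)"
  by unfold_locales (simp_all add: distrib_right scale_mult_left)

lemma subspace_vimage_left_mult: "subspace W \<Longrightarrow> subspace {x. a * x \<in> W}"
  using module_hom.subspace_vimage[OF scale_linear_left_mult, of W a] by (simp add: vimage_def)

lemma subspace_vimage_right_mult: "subspace W \<Longrightarrow> subspace {x. x * a \<in> W}"
  using module_hom.subspace_vimage[OF scale_linear_right_mult, of W a] by (simp add: vimage_def)

lemma subspace_vimage_commutator:
  assumes "subspace W"
  shows "subspace {x. commutator a x \<in> W}"
proof -
  interpret module_hom scale scale "commutator a"
    by unfold_locales
      (simp_all add: commutator_def algebra_simps scale_mult_left scale_mult_right
        scale_right_diff_distrib)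
  show ?thesis using subspace_vimage[OF assms] by (simp add: vimage_def)
qed

lemma commutator_swap: "commutator x y = - commutator y x"
  by (simp add: commutator_def)

lemma subspace_set_plus: "subspace S \<Longrightarrow> subspace T \<Longrightarrow> subspace (S + T)"
proof -
  assume "subspace S" "subspace T"
  moreover have "S + T = {x + y | x y. x \<in> S \<and> y \<in> T}" by (auto simp: set_plus_def)
  ultimately show ?thesis using subspace_sums by simp
qed

lemma commutator_in_lie_product: "x \<in> U \<Longrightarrow> y \<in> V \<Longrightarrow> commutator x y \<in> lie_product U V"
  unfolding lie_product_def by (auto intro: span_base)

definition lie_ideal :: "'a set \<Rightarrow> bool" where
  "lie_ideal U \<longleftrightarrow> subspace U \<and> (\<forall>a. \<forall>u\<in>U. commutator a u \<in> U)"

lemma lie_ideal_UNIV: "lie_ideal UNIV"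
  by (simp add: lie_ideal_def)

text \<open>By the Jacobi identity, \<open>commutator a\<close> is a derivation of the
  bracket.\<close>

lemma lie_ideal_lie_product:
  assumes "lie_ideal U"
  shows "lie_ideal (lie_product U U)"
  unfolding lie_ideal_def
proof (intro conjI allI ballI)
  show sub: "subspace (lie_product U U)" by (simp add: lie_product_def)
  fix a x assume "x \<in> lie_product U U"
  then show "commutator a x \<in> lie_product U U"
    unfolding lie_product_def
  proof (induction rule: span_induct)
    case base
    show ?case using subspace_vimage_commutator[OF sub] by (simp add: lie_product_def)
  next
    case (step x)
    then obtain u v where x: "x = commutator u v" and uv: "u \<in> U" "v \<in> U" by auto
    have "commutator a x = commutator (commutator a u) v + commutator u (commutator a v)"
      by (simp add: x commutator_def algebra_simps)
    moreover have "commutator a u \<in> U" "commutator a v \<in> U"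
      using assms uv by (auto simp: lie_ideal_def)
    ultimately have "commutator a x \<in> lie_product U U"
      using sub uv by (auto intro!: subspace_add commutator_in_lie_product)
    then show ?case by (simp add: lie_product_def)
  qed
qed

text \<open>\<open>commutator a\<close> is also a derivation of the associative product, so it
  preserves the span of the products \<open>u * v\<close> as well as \<open>U\<close>.\<close>

lemma lie_ideal_assoc_product_plus:
  assumes "lie_ideal U"
  shows "lie_ideal (assoc_product U U + U)"
proof -
  let ?W = "assoc_product U U + U"
  have subU: "subspace U" using assms by (simp add: lie_ideal_def)
  have subP: "subspace (assoc_product U U)" by (simp add: assoc_product_def)
  have P: "commutator a x \<in> assoc_product U U" if "x \<in> assoc_product U U" for a x
    using that unfolding assoc_product_def
  proof (induction rule: span_induct)
    case base
    show ?case using subspace_vimage_commutator[OF subP] by (simp add: assoc_product_def)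
  next
    case (step x)
    then obtain u v where x: "x = u * v" and uv: "u \<in> U" "v \<in> U" by auto
    have eq: "commutator a x = commutator a u * v + u * commutator a v"
      by (simp add: x commutator_def algebra_simps)
    have "commutator a u \<in> U" "commutator a v \<in> U"
      using assms uv by (auto simp: lie_ideal_def)
    with uv show ?case unfolding eq
      by (intro span_add) (auto intro!: span_base)
  qed
  have "commutator a x \<in> ?W" if xW: "x \<in> ?W" for a x
  proof -
    obtain p u where x: "x = p + u" and p: "p \<in> assoc_product U U" and u: "u \<in> U"
      using xW by (auto simp: set_plus_def)
    have "commutator a x = commutator a p + commutator a u"
      by (simp add: x commutator_def algebra_simps)
    with P[OF p] u assms show ?thesis by (auto simp: lie_ideal_def intro: set_plus_intro)
  qed
  with subspace_set_plus[OF subP subU] show ?thesis by (simp add: lie_ideal_def)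
qed

text \<open>
  Herstein: \<open>[u, v] a = [u, v a] - v [u, a]\<close> lies in \<open>U U + U\<close>, which is itself closed under
  commutators with \<open>A\<close>; the witness is the largest two-sided ideal inside \<open>U U + U\<close>.
\<close>
lemma ideal_of_commutators_in_assoc_product_plus:
  assumes U: "lie_ideal U"
  obtains I where "two_sided_ideal I" "lie_product U U \<subseteq> I" "I \<subseteq> assoc_product U U + U"
proof -
  define W where "W = assoc_product U U + U"
  define I where "I = {x. x \<in> W \<and> (\<forall>a. x * a \<in> W) \<and> (\<forall>b. b * x \<in> W) \<and> (\<forall>a b. b * x * a \<in> W)}"
  have subU: "subspace U" using U by (simp add: lie_ideal_def)
  have W: "lie_ideal W" unfolding W_def by (rule lie_ideal_assoc_product_plus[OF U])
  then have subW: "subspace W" by (simp add: lie_ideal_def)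
  have UW: "u \<in> W" if "u \<in> U" for u
    using set_plus_intro[of 0 "assoc_product U U" u U] that
    by (simp add: W_def assoc_product_def span_zero)
  have UUW: "u * v \<in> W" if "u \<in> U" "v \<in> U" for u v
    using set_plus_intro[of "u * v" "assoc_product U U" 0 U] that subspace_0[OF subU]
    by (auto simp: W_def assoc_product_def intro: span_base)
  have subI: "subspace I"
    using subW unfolding I_def subspace_def
    by (simp add: distrib_left distrib_right scale_mult_left scale_mult_right)
  have idI: "two_sided_ideal I"
    unfolding two_sided_ideal_def using subI
    by (auto simp: I_def mult.assoc[symmetric]) (auto simp: mult.assoc)
  have right: "commutator u v * a \<in> W" if uv: "u \<in> U" "v \<in> U" for u v a
  proof -
    have eq: "commutator u v * a = commutator u (v * a) - v * commutator u a"
      by (simp add: commutator_def algebra_simps)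
    have in_U: "commutator u c \<in> U" for c
      using U uv subspace_neg[OF subU] commutator_swap[of u c] by (auto simp: lie_ideal_def)
    show ?thesis unfolding eq
      using subspace_diff[OF subW] UW[OF in_U] UUW[OF uv(2) in_U] by blast
  qed
  \<comment> \<open>Closure of \<open>W\<close> under commutators trades left multiplication for
    right multiplication. Applied to \<open>commutator u v * a\<close>, this also settles the
    products with factors on both sides.\<close>
  have left: "b * x \<in> W" if "x \<in> W" "x * b \<in> W" for b x
  proof -
    have "b * x = commutator b x + x * b" by (simp add: commutator_def)
    moreover have "commutator b x \<in> W" using W that by (auto simp: lie_ideal_def)
    ultimately show ?thesis using subspace_add[OF subW] that by simp
  qed
  have comm: "commutator u v \<in> W" if "u \<in> U" "v \<in> U" for u v
    using UW U that by (auto simp: lie_ideal_def)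
  have "commutator u v \<in> I" if uv: "u \<in> U" "v \<in> U" for u v
    unfolding I_def using comm right left uv by (auto simp: mult.assoc)
  then have "lie_product U U \<subseteq> I"
    unfolding lie_product_def by (intro span_minimal subI) auto
  then show ?thesis using that idI by (auto simp: I_def W_def)
qed

text \<open>Reduces both conclusions to one statement about ideals: no proper two-sided ideal
  contains \<open>lie_product D D\<close>.\<close>

lemma lie_perfect_derived_if_no_ideal:
  defines "D \<equiv> lie_product derived derived"
  assumes no_ideal: "\<And>I. two_sided_ideal I \<Longrightarrow> lie_product D D \<subseteq> I \<Longrightarrow> I = UNIV"
  shows "lie_perfect derived \<and> UNIV = assoc_product derived derived + derived"
proof -
  have L: "lie_ideal derived" unfolding derived_def by (rule lie_ideal_lie_product[OF lie_ideal_UNIV])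
  have D: "lie_ideal D" unfolding D_def by (rule lie_ideal_lie_product[OF L])
  have subD: "subspace D" using D by (simp add: lie_ideal_def)
  have subL: "subspace derived" using L by (simp add: lie_ideal_def)
  have DL: "D \<subseteq> derived"
    unfolding D_def lie_product_def
    using lie_subalgebra_derived by (intro span_minimal) (auto simp: lie_subalgebra_def)
  obtain I where "two_sided_ideal I" "lie_product D D \<subseteq> I" "I \<subseteq> assoc_product D D + D"
    by (rule ideal_of_commutators_in_assoc_product_plus[OF D])
  then have A: "UNIV = assoc_product D D + D" using no_ideal by blast
  have "assoc_product D D \<subseteq> assoc_product derived derived"
    unfolding assoc_product_def using DL by (intro span_mono) blast
  then have A': "UNIV = assoc_product derived derived + derived"
    using A DL set_plus_mono2[of "assoc_product D D" "assoc_product derived derived" D derived]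
    by auto
  have prod: "commutator a x \<in> D" if "x \<in> assoc_product D D" for a x
    using that unfolding assoc_product_def
  proof (induction rule: span_induct)
    case base
    show ?case by (rule subspace_vimage_commutator[OF subD])
  next
    case (step x)
    then obtain u v where x: "x = u * v" and uv: "u \<in> D" "v \<in> D" by auto
    have "commutator a x = commutator (a * u) v + commutator (v * a) u"
      by (simp add: x commutator_def algebra_simps)
    then show ?case using D uv subspace_add[OF subD] by (auto simp: lie_ideal_def)
  qed
  have "commutator a x \<in> D" for a x
  proof -
    obtain p u where x: "x = p + u" and p: "p \<in> assoc_product D D" and u: "u \<in> D"
      using A set_plus_elim[of x "assoc_product D D" D] by blast
    have "commutator a x = commutator a p + commutator a u"
      by (simp add: x commutator_def algebra_simps)
    then show ?thesis using prod[OF p] D u subspace_add[OF subD] by (auto simp: lie_ideal_def)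
  qed
  then have "derived \<subseteq> D"
    unfolding derived_def lie_product_def by (intro span_minimal subD) auto
  with DL have "D = derived" by blast
  then have "lie_perfect derived" by (simp add: lie_perfect_def lie_subalgebra_derived D_def)
  with A' show ?thesis by blast
qed

section \<open>Simple modules, Schur's lemma and the density theorem\<close>

definition left_ideal :: "'a set \<Rightarrow> bool" where
  "left_ideal J \<longleftrightarrow> subspace J \<and> (\<forall>a. \<forall>x\<in>J. a * x \<in> J)"

end

text \<open>The module \<open>A / J\<close> is not formed as a type: its vectors are elements of
  \<open>A\<close>, and equality is congruence modulo \<open>J\<close>. Since \<open>A\<close> may
  lack a unit, \<open>nontrivial_J\<close> has to exclude the zero action on
  \<open>A / J\<close>.\<close>

locale simple_quotient_module = finite_dimensional_algebra scale Basis
  for scale :: "'k::alg_closed_field \<Rightarrow> 'a::ring \<Rightarrow> 'a" and Basis :: "'a set" +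
  fixes J :: "'a set"
  assumes left_ideal_J: "left_ideal J"
    and maximal_J: "left_ideal K \<Longrightarrow> J \<subseteq> K \<Longrightarrow> K = J \<or> K = UNIV"
    and nontrivial_J: "\<exists>a b. a * b \<notin> J"
begin

lemma subspace_J: "subspace J"
  using left_ideal_J by (simp add: left_ideal_def)

lemma mult_J: "x \<in> J \<Longrightarrow> a * x \<in> J"
  using left_ideal_J by (simp add: left_ideal_def)

lemmas J_zero = subspace_0[OF subspace_J]
  and J_add = subspace_add[OF subspace_J]
  and J_diff = subspace_diff[OF subspace_J]
  and J_scale = subspace_scale[OF subspace_J]
  and J_sum = subspace_sum[OF subspace_J]

lemmas J_closed = J_zero J_add J_diff J_scale J_sum mult_J

text \<open>The vectors killed by all of \<open>A\<close> form a submodule of the simple module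
  \<open>A / J\<close>; it is not the whole module by \<open>nontrivial_J\<close>, hence it is
  zero.\<close>

lemma in_J_if_annihilated:
  assumes "\<And>a. a * v \<in> J"
  shows "v \<in> J"
proof -
  let ?K = "{v. \<forall>a. a * v \<in> J}"
  have "left_ideal ?K"
    unfolding left_ideal_def subspace_def
    by (auto simp: distrib_left scale_mult_right J_closed mult.assoc[symmetric])
  moreover have "?K \<noteq> UNIV" using nontrivial_J by auto
  moreover have "J \<subseteq> ?K" by (auto intro: mult_J)
  ultimately have "?K = J" using maximal_J by blast
  with assms show ?thesis by blast
qed

lemma left_ideal_orbit:
  assumes K: "left_ideal K"
  shows "left_ideal {a * v + j | a j. a \<in> K \<and> j \<in> J}"
  unfolding left_ideal_def
proof (intro conjI allI ballI)
  have "subspace ((\<lambda>a. a * v) ` K)"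
    using module_hom.subspace_image[OF scale_linear_right_mult] K by (simp add: left_ideal_def)
  then have "subspace ((\<lambda>a. a * v) ` K + J)" by (rule subspace_set_plus[OF _ subspace_J])
  moreover have "(\<lambda>a. a * v) ` K + J = {a * v + j | a j. a \<in> K \<and> j \<in> J}"
    by (auto simp: set_plus_def)
  ultimately show "subspace {a * v + j | a j. a \<in> K \<and> j \<in> J}" by simp
  fix b x assume "x \<in> {a * v + j | a j. a \<in> K \<and> j \<in> J}"
  then obtain a j where "x = a * v + j" "a \<in> K" "j \<in> J" by auto
  then have "b * x = (b * a) * v + b * j" "b * a \<in> K" "b * j \<in> J"
    using K by (auto simp: left_ideal_def J_closed distrib_left mult.assoc)
  then show "b * x \<in> {a * v + j | a j. a \<in> K \<and> j \<in> J}" by blast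
qed

text \<open>\<open>K v + J\<close> is a left ideal strictly larger than \<open>J\<close>, so it is
  everything by maximality.\<close>

lemma left_ideal_transitive:
  assumes K: "left_ideal K" and k: "k \<in> K" "k * v \<notin> J"
  obtains a where "a \<in> K" "a * v - t \<in> J"
proof -
  let ?N = "{a * v + j | a j. a \<in> K \<and> j \<in> J}"
  have 0: "0 \<in> K" using K by (auto simp: left_ideal_def subspace_0)
  have "j = 0 * v + j" for j by simp
  with 0 have "J \<subseteq> ?N" by blast
  moreover have "k * v = k * v + 0" by simp
  then have "k * v \<in> ?N" using k(1) J_zero by blast
  ultimately have "?N = UNIV" using maximal_J[OF left_ideal_orbit[OF K, of v]] k by blast
  then obtain a j where "t = a * v + j" "a \<in> K" "j \<in> J" by blast
  then show ?thesis using that[of a] J_diff[OF J_zero, of j] by simp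
qed

text \<open>
  Schur's lemma for the endomorphism \<open>a v \<mapsto> a w\<close> of \<open>A / J\<close>: an eigenvalue is read off a polynomial
  relation between the iterates \<open>s i\<close> of a vector.
\<close>
lemma endomorphism_eigenvalue:
  assumes K: "left_ideal K" and k: "k \<in> K" "k * v \<notin> J"
  obtains c a where "a \<in> K" "a * v \<notin> J" "a * w - scale c (a * v) \<in> J"
proof -
  have "\<exists>b. b \<in> K \<and> b * v - a * w \<in> J" for a
    using left_ideal_transitive[OF K k] by metis
  \<comment> \<open>\<open>T\<close> lifts the correspondence \<open>a v \<mapsto> a w\<close> to
    representatives in \<open>K\<close>; it is a mere choice function and need not be linear. Modulo
    \<open>J\<close>, \<open>s n * v\<close> plays the n-th iterate of \<open>k * v\<close>.\<close>
  then obtain T where TK: "T a \<in> K" and T: "T a * v - a * w \<in> J" for a by metis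
  define s where "s n = (T ^^ n) k" for n
  have sK: "s n \<in> K" for n by (cases n) (simp_all add: s_def k TK)
  have s_Suc: "s (Suc n) * v - s n * w \<in> J" for n by (simp add: s_def T)
  define N where "N = dimension"
  \<comment> \<open>\<open>E p * v\<close> represents the polynomial \<open>p\<close> in the
    endomorphism, applied to \<open>k * v\<close>.\<close>
  define E where "E p = (\<Sum>i\<le>N. scale (coeff p i) (s i))" for p
  have EK: "E p \<in> K" for p
    unfolding E_def using K sK by (auto simp: left_ideal_def intro!: subspace_sum subspace_scale)
  have E_diff: "E (p - q) = E p - E q" for p q
    by (simp add: E_def sum_subtractf scale_left_diff_distrib)
  have E_smult: "E (smult c p) = scale c (E p)" for c p
    by (simp add: E_def scale_sum_right)
  \<comment> \<open>Multiplication by the indeterminate applies the endomorphism once. The strict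
    degree bound keeps the shifted leading coefficient inside the sum up to
    \<open>N\<close>.\<close>
  have E_shift: "E (pCons 0 q) * v - E q * w \<in> J" if q: "degree q < N" for q
  proof -
    from q obtain m where m: "N = Suc m" by (cases N) auto
    have "E (pCons 0 q) = (\<Sum>i\<le>m. scale (coeff q i) (s (Suc i)))"
      unfolding E_def m by (subst sum.atMost_Suc_shift) simp
    moreover have "E q = (\<Sum>i\<le>m. scale (coeff q i) (s i))"
      using q by (simp add: E_def m coeff_eq_0)
    ultimately have "E (pCons 0 q) * v - E q * w =
        (\<Sum>i\<le>m. scale (coeff q i) (s (Suc i) * v - s i * w))"
      by (simp add: sum_distrib_right scale_mult_left scale_right_diff_distrib sum_subtractf)
    then show ?thesis by (auto intro!: J_closed s_Suc)
  qed
  have "\<exists>c a. a \<in> K \<and> a * v \<notin> J \<and> a * w - scale c (a * v) \<in> J"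
  proof (rule ccontr)
    assume no_eigen: "\<not> ?thesis"
    have "E p * v \<notin> J" if "p \<noteq> 0" "degree p \<le> N" for p
      using that
    proof (induction "degree p" arbitrary: p)
      case 0
      then obtain c where p: "p = [:c:]" "c \<noteq> 0" by (metis degree_eq_zeroE pCons_eq_0_iff)
      have "E p = (\<Sum>i\<le>N. if i = 0 then scale c (s 0) else 0)"
        unfolding E_def by (intro sum.cong) (auto simp: p coeff_pCons split: nat.split)
      then have E: "E p = scale c k" by (simp add: s_def)
      have "k * v \<in> J" if "E p * v \<in> J"
        using J_scale[OF that, of "inverse c"] p(2) by (simp add: E scale_mult_left)
      with k show ?case by blast
    next
      case (Suc n)
      have "0 < degree p" using Suc by simp
      \<comment> \<open>Algebraic closedness splits off a linear factor. If \<open>E p * v\<close>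
        lay in \<open>J\<close>, then \<open>E q\<close>, with \<open>E q * v\<close> outside
        \<open>J\<close> by induction, would satisfy the eigenvalue equation for
        \<open>c\<close>.\<close>
      then obtain c where "poly p c = 0" using alg_closed_imp_poly_has_root by blast
      then obtain q where pq: "p = [:- c, 1:] * q" by (auto simp: poly_eq_0_iff_dvd elim: dvdE)
      then have q0: "q \<noteq> 0" using Suc.prems by auto
      then have "degree p = Suc (degree q)" unfolding pq by (subst degree_mult_eq) auto
      with Suc.hyps q0 have q: "q \<noteq> 0" "degree q = n" by simp_all
      have p: "p = pCons 0 q - smult c q" by (simp add: pq)
      have Ep: "E p * v = (E (pCons 0 q) * v - E q * w) + (E q * w - scale c (E q * v))"
        by (simp add: p E_diff E_smult left_diff_distrib scale_mult_left)
      have "degree q < N" using q Suc by simp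
      note 1 = E_shift[OF this]
      have "E q * v \<notin> J" using Suc q by simp
      then have 2: "E q * w - scale c (E q * v) \<notin> J" using no_eigen EK by blast
      show ?case
      proof
        assume "E p * v \<in> J"
        from J_diff[OF this 1] have "E q * w - scale c (E q * v) \<in> J" by (simp add: Ep)
        with 2 show False by blast
      qed
    qed
    moreover obtain p :: "'k poly" where "p \<noteq> 0" "degree p \<le> N" "E p = 0"
      using exists_linear_relation[of s] by (auto simp: E_def N_def)
    ultimately show False using J_zero by (metis mult_zero_left)
  qed
  then show ?thesis using that by blast
qed

text \<open>The elements of \<open>K\<close> satisfying the eigenvalue equation form a left ideal
  \<open>K'\<close> that does not kill \<open>v\<close>, so \<open>K' v\<close> covers
  \<open>A / J\<close>. The hypothesis \<open>wd\<close> makes \<open>a v \<mapsto> a w\<close> well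
  defined and extends the equation from \<open>K'\<close> to \<open>K\<close>.\<close>

lemma endomorphism_scalar:
  assumes K: "left_ideal K" and k: "k \<in> K" "k * v \<notin> J"
    and wd: "\<And>a. a \<in> K \<Longrightarrow> a * v \<in> J \<Longrightarrow> a * w \<in> J"
  obtains c where "\<And>a. a \<in> K \<Longrightarrow> a * (w - scale c v) \<in> J"
proof -
  obtain c a where a: "a \<in> K" "a * v \<notin> J" "a * w - scale c (a * v) \<in> J"
    by (rule endomorphism_eigenvalue[OF K k])
  have subK: "subspace K" using K by (simp add: left_ideal_def)
  define K' where "K' = {b \<in> K. b * w - scale c (b * v) \<in> J}"
  have "left_ideal K'"
    unfolding left_ideal_def
  proof (intro conjI allI ballI)
    have "K' = K \<inter> {b. b * (w - scale c v) \<in> J}"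
      by (auto simp: K'_def right_diff_distrib scale_mult_right)
    then show "subspace K'"
      using subspace_inter[OF subK subspace_vimage_right_mult[OF subspace_J]] by simp
    fix d b assume "b \<in> K'"
    then have "d * b \<in> K" "d * (b * w - scale c (b * v)) \<in> J"
      using K J_closed by (auto simp: K'_def left_ideal_def)
    then show "d * b \<in> K'" by (simp add: K'_def right_diff_distrib scale_mult_right mult.assoc)
  qed
  moreover have "a \<in> K'" using a by (simp add: K'_def)
  ultimately have trans: "\<exists>b\<in>K'. b * v - t \<in> J" for t
    using left_ideal_transitive[of K' a v t] a by blast
  have "b * (w - scale c v) \<in> J" if b: "b \<in> K" for b
  proof -
    obtain d where d: "d \<in> K" "d * w - scale c (d * v) \<in> J" "d * v - b * v \<in> J"
      using trans[of "b * v"] by (auto simp: K'_def)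
    have dbK: "d - b \<in> K" using subspace_diff[OF subK] d b by blast
    have dbv: "(d - b) * v \<in> J" using d by (simp add: left_diff_distrib)
    have dbw: "(d - b) * w \<in> J" by (rule wd[OF dbK dbv])
    have "b * (w - scale c v) = d * w - scale c (d * v) - (d - b) * w + scale c ((d - b) * v)"
      by (simp add: algebra_simps scale_mult_right scale_right_diff_distrib)
    then show ?thesis using d dbv dbw by (simp add: J_closed)
  qed
  then show ?thesis by (rule that)
qed

definition annihilator :: "'a set \<Rightarrow> 'a set" where
  "annihilator S = {a. \<forall>s\<in>S. a * s \<in> J}"

lemma left_ideal_annihilator: "left_ideal (annihilator S)"
  unfolding left_ideal_def subspace_def annihilator_def
  by (auto simp: distrib_right scale_mult_left mult.assoc J_closed)

text \<open>Double annihilator property, by induction on \<open>S\<close>. If the annihilator of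
  \<open>S\<close> moves \<open>v\<close>, Schur's lemma over that left ideal shows that it kills
  \<open>w - scale c v\<close> for some \<open>c\<close>; otherwise adding \<open>v\<close> does not
  change the annihilator.\<close>

lemma in_span_if_annihilated:
  assumes "finite S" and "\<And>a. a \<in> annihilator S \<Longrightarrow> a * w \<in> J"
  shows "w \<in> span (S \<union> J)"
  using assms
proof (induction S arbitrary: w rule: finite_induct)
  case empty
  then show ?case using in_J_if_annihilated[of w] span_base by (auto simp: annihilator_def)
next
  case (insert v S)
  have ann: "annihilator (insert v S) = {a \<in> annihilator S. a * v \<in> J}"
    by (auto simp: annihilator_def)
  have mono: "span (S \<union> J) \<subseteq> span (insert v S \<union> J)" by (intro span_mono) auto
  show ?case
  proof (cases "\<exists>k\<in>annihilator S. k * v \<notin> J")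
    case True
    then obtain k where k: "k \<in> annihilator S" "k * v \<notin> J" by blast
    obtain c where "\<And>a. a \<in> annihilator S \<Longrightarrow> a * (w - scale c v) \<in> J"
      by (rule endomorphism_scalar[OF left_ideal_annihilator k, of w])
        (use insert.prems ann in blast)+
    then have "w - scale c v \<in> span (S \<union> J)" by (rule insert.IH)
    then show ?thesis by (auto simp: span_insert)
  next
    case False
    then have "w \<in> span (S \<union> J)" using insert.IH insert.prems ann by blast
    then show ?thesis using mono by blast
  qed
qed

text \<open>Linear independence of the first \<open>n\<close> vectors in \<open>A / J\<close>, in a
  sequential form suited to induction on \<open>n\<close>.\<close>

definition indep_mod :: "nat \<Rightarrow> (nat \<Rightarrow> 'a) \<Rightarrow> bool" where
  "indep_mod n v \<longleftrightarrow> (\<forall>i<n. v i \<notin> span (v ` {..<i} \<union> J))"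

definition acts :: "'a \<Rightarrow> 'a \<Rightarrow> 'a \<Rightarrow> bool" where
  "acts a v u \<longleftrightarrow> a * v - u \<in> J"

text \<open>Jacobson density: the element found for the first \<open>n\<close> vectors is corrected
  by one that kills them and adjusts only the value at \<open>v n\<close>.\<close>

lemma density:
  assumes "indep_mod n v"
  shows "\<exists>a. \<forall>i<n. acts a (v i) (f i)"
  using assms
proof (induction n)
  case (Suc n)
  then obtain a where a: "a * v i - f i \<in> J" if "i < n" for i
    by (auto simp: indep_mod_def acts_def)
  have "v n \<notin> span (v ` {..<n} \<union> J)" using Suc.prems by (simp add: indep_mod_def)
  then obtain k where "k \<in> annihilator (v ` {..<n})" "k * v n \<notin> J"
    using in_span_if_annihilated by blast
  from left_ideal_transitive[OF left_ideal_annihilator this]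
  obtain b where b: "b \<in> annihilator (v ` {..<n})" "b * v n - (f n - a * v n) \<in> J" by metis
  have "(a + b) * v i - f i \<in> J" if i: "i < Suc n" for i
  proof (cases "i = n")
    case True
    then show ?thesis using b by (simp add: algebra_simps)
  next
    case False
    with i have "i < n" by simp
    with b have "b * v i \<in> J" by (auto simp: annihilator_def)
    from J_add[OF a[OF \<open>i < n\<close>] this] show ?thesis by (simp add: algebra_simps)
  qed
  then show ?case unfolding acts_def by blast
qed simp

section \<open>Configurations from \<open>sl_2\<close> and \<open>sl_3\<close> that survive
  brackets\<close>

lemma acts_zero: "acts a 0 0"
  by (simp add: acts_def J_closed)

lemma acts_scale: "acts a v u \<Longrightarrow> acts a (scale c v) (scale c u)"
  unfolding acts_def using J_scale[of "a * v - u" c]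
  by (simp add: scale_mult_right scale_right_diff_distrib)

lemma acts_commutator:
  assumes "acts y v u" "acts x u t" "acts x v u'" "acts y u' t'"
  shows "acts (commutator x y) v (t - t')"
proof -
  have "commutator x y * v - (t - t') =
      (x * (y * v - u) + (x * u - t)) - (y * (x * v - u') + (y * u' - t'))"
    by (simp add: commutator_def algebra_simps)
  moreover have "\<dots> \<in> J"
    using assms unfolding acts_def
    by (intro J_diff[OF J_add J_add] mult_J)
  ultimately show ?thesis unfolding acts_def by metis
qed

text \<open>\<open>x\<close>, \<open>y\<close>, \<open>z\<close> act as nonzero multiples of
  \<open>e\<close>, \<open>f\<close>, \<open>h\<close>. The free factors \<open>c\<close>,
  \<open>d\<close>, \<open>g\<close> absorb the constants that brackets produce.\<close>

definition contains_sl2 :: "(nat \<Rightarrow> 'a) \<Rightarrow> 'a set \<Rightarrow> bool" where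
  "contains_sl2 v U \<longleftrightarrow> (\<exists>x\<in>U. \<exists>y\<in>U. \<exists>z\<in>U. \<exists>c d g. c \<noteq> 0 \<and> d \<noteq> 0 \<and> g \<noteq> 0 \<and>
     acts x (v 0) 0 \<and> acts x (v 1) (scale c (v 0)) \<and>
     acts y (v 0) (scale d (v 1)) \<and> acts y (v 1) 0 \<and>
     acts z (v 0) (scale g (v 0)) \<and> acts z (v 1) (scale (- g) (v 1)))"

text \<open>The relations \<open>[h, e] = 2 e\<close>, \<open>[f, h] = 2 f\<close> and
  \<open>[e, f] = h\<close> reproduce the triple; the factors stay nonzero because \<open>2\<close>
  is invertible.\<close>

lemma contains_sl2_lie_product:
  assumes two: "(2::'k) \<noteq> 0" and U: "contains_sl2 v U"
  shows "contains_sl2 v (lie_product U U)"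
proof -
  obtain x y z c d g where xyz: "x \<in> U" "y \<in> U" "z \<in> U" and nz: "c \<noteq> 0" "d \<noteq> 0" "g \<noteq> 0"
    and x: "acts x (v 0) 0" "acts x (v 1) (scale c (v 0))"
    and y: "acts y (v 0) (scale d (v 1))" "acts y (v 1) 0"
    and z: "acts z (v 0) (scale g (v 0))" "acts z (v 1) (scale (- g) (v 1))"
    using U unfolding contains_sl2_def by blast
  have "acts (commutator z x) (v 0) (0 - scale g 0)"
    by (intro acts_commutator[OF x(1) acts_zero z(1)] acts_scale x)
  then have 1: "acts (commutator z x) (v 0) 0" by simp
  have "acts (commutator z x) (v 1) (scale c (scale g (v 0)) - scale (- g) (scale c (v 0)))"
    by (intro acts_commutator[OF x(2) _ z(2)] acts_scale x z)
  then have 2: "acts (commutator z x) (v 1) (scale (2 * c * g) (v 0))"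
    by (simp add: scale_left_distrib[symmetric] scale_left_diff_distrib[symmetric] algebra_simps)
  have "acts (commutator y z) (v 0) (scale g (scale d (v 1)) - scale d (scale (- g) (v 1)))"
    by (intro acts_commutator[OF z(1) _ y(1)] acts_scale y z)
  then have 3: "acts (commutator y z) (v 0) (scale (2 * g * d) (v 1))"
    by (simp add: scale_left_distrib[symmetric] scale_left_diff_distrib[symmetric] algebra_simps)
  have "acts (commutator y z) (v 1) (scale (- g) 0 - 0)"
    by (intro acts_commutator[OF z(2) _ y(2) acts_zero] acts_scale y)
  then have 4: "acts (commutator y z) (v 1) 0" by simp
  have "acts (commutator x y) (v 0) (scale d (scale c (v 0)) - 0)"
    by (intro acts_commutator[OF y(1) _ x(1) acts_zero] acts_scale x)
  then have 5: "acts (commutator x y) (v 0) (scale (d * c) (v 0))" by simp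
  have "acts (commutator x y) (v 1) (0 - scale c (scale d (v 1)))"
    by (intro acts_commutator[OF y(2) acts_zero x(2)] acts_scale y)
  then have 6: "acts (commutator x y) (v 1) (scale (- (d * c)) (v 1))"
    by (simp add: mult.commute)
  have "2 * c * g \<noteq> 0" "2 * g * d \<noteq> 0" "d * c \<noteq> 0" using nz two by simp_all
  moreover have "commutator z x \<in> lie_product U U" "commutator y z \<in> lie_product U U"
    "commutator x y \<in> lie_product U U"
    using xyz by (auto intro: commutator_in_lie_product)
  ultimately show ?thesis
    unfolding contains_sl2_def
    by (intro bexI exI conjI) (rule 1 2 3 4 5 6 | assumption)+
qed

lemma contains_sl2_UNIV:
  assumes v: "indep_mod 2 v"
  shows "contains_sl2 v UNIV"
proof -
  have "\<exists>a. acts a (v 0) t \<and> acts a (v 1) u" for t u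
    using density[OF v, of "\<lambda>i. if i = 0 then t else u"]
    by (metis One_nat_def lessI less_2_cases_iff zero_neq_one)
  note act = this
  obtain x where x: "acts x (v 0) 0" "acts x (v 1) (scale 1 (v 0))" using act by blast
  obtain y where y: "acts y (v 0) (scale 1 (v 1))" "acts y (v 1) 0" using act by blast
  obtain z where z: "acts z (v 0) (scale 1 (v 0))" "acts z (v 1) (scale (- 1) (v 1))"
    using act by blast
  show ?thesis
    unfolding contains_sl2_def
    by (rule bexI[of _ x], rule bexI[of _ y], rule bexI[of _ z], (rule exI[of _ 1])+)
      (intro conjI one_neq_zero x y z UNIV_I)+
qed

text \<open>A two-sided ideal inside \<open>J\<close> annihilates \<open>A / J\<close>, whereas
  \<open>z\<close> multiplies the nonzero vector \<open>v 0\<close> by \<open>g\<close>.\<close>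

lemma not_contains_sl2:
  assumes "indep_mod 2 v" "two_sided_ideal I" "I \<subseteq> J" "U \<subseteq> I"
  shows "\<not> contains_sl2 v U"
proof
  assume "contains_sl2 v U"
  then obtain z g where z: "z \<in> U" "g \<noteq> 0" "z * v 0 - scale g (v 0) \<in> J"
    unfolding contains_sl2_def acts_def by blast
  then have "z * v 0 \<in> J" using assms by (auto simp: two_sided_ideal_def)
  from J_diff[OF this z(3)] have "scale g (v 0) \<in> J" by simp
  from J_scale[OF this, of "inverse g"] have "v 0 \<in> J" using z by simp
  then have "v 0 \<in> span (v ` {..<0} \<union> J)" by (auto intro: span_base)
  with assms(1) show False unfolding indep_mod_def by (metis zero_less_numeral)
qed

text \<open>The witnesses act on the three vectors as the off-diagonal matrix units
  \<open>E_ij\<close>.\<close>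

definition contains_root_vectors :: "(nat \<Rightarrow> 'a) \<Rightarrow> 'a set \<Rightarrow> bool" where
  "contains_root_vectors v U \<longleftrightarrow> (\<forall>i<3. \<forall>j<3. i \<noteq> j \<longrightarrow>
     (\<exists>x\<in>U. \<forall>k<3. acts x (v k) (if k = j then v i else 0)))"

text \<open>With a third index \<open>k\<close>, \<open>E_ij = [E_ik, E_kj]\<close> in every
  characteristic.\<close>

lemma contains_root_vectors_lie_product:
  assumes U: "contains_root_vectors v U"
  shows "contains_root_vectors v (lie_product U U)"
  unfolding contains_root_vectors_def
proof (intro allI impI)
  fix i j :: nat assume ij: "i < 3" "j < 3" "i \<noteq> j"
  have "\<exists>k<3. k \<noteq> i \<and> k \<noteq> j" using ij by presburger
  then obtain k where k: "k < 3" "k \<noteq> i" "k \<noteq> j" by blast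
  obtain x where x: "x \<in> U" "\<And>l. l < 3 \<Longrightarrow> acts x (v l) (if l = k then v i else 0)"
    using U ij k unfolding contains_root_vectors_def by metis
  obtain y where y: "y \<in> U" "\<And>l. l < 3 \<Longrightarrow> acts y (v l) (if l = j then v k else 0)"
    using U ij k unfolding contains_root_vectors_def by metis
  have "acts (commutator x y) (v l) (if l = j then v i else 0)" if l: "l < 3" for l
  proof -
    have "acts x (if l = j then v k else 0) (if l = j then v i else 0)"
      using x(2)[OF k(1)] acts_zero by simp
    moreover have "acts y (if l = k then v i else 0) 0"
      using y(2)[OF ij(1)] ij acts_zero by simp
    ultimately have "acts (commutator x y) (v l) ((if l = j then v i else 0) - 0)"
      by (rule acts_commutator[OF y(2)[OF l] _ x(2)[OF l]])
    then show ?thesis by simp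
  qed
  with x y show "\<exists>x\<in>lie_product U U. \<forall>l<3. acts x (v l) (if l = j then v i else 0)"
    by (blast intro: commutator_in_lie_product)
qed

lemma contains_root_vectors_UNIV:
  assumes "indep_mod 3 v"
  shows "contains_root_vectors v UNIV"
  unfolding contains_root_vectors_def
proof (intro allI impI)
  fix i j :: nat
  show "\<exists>x\<in>UNIV. \<forall>k<3. acts x (v k) (if k = j then v i else 0)"
    using density[OF assms, of "\<lambda>k. if k = j then v i else 0"] by simp
qed

lemma not_contains_root_vectors:
  assumes "indep_mod 3 v" "two_sided_ideal I" "I \<subseteq> J" "U \<subseteq> I"
  shows "\<not> contains_root_vectors v U"
proof
  assume "contains_root_vectors v U"
  then have "\<exists>x\<in>U. \<forall>k<3. acts x (v k) (if k = 1 then v 0 else 0)"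
    unfolding contains_root_vectors_def by simp
  then obtain x where x: "x \<in> U" "\<forall>k<3. acts x (v k) (if k = 1 then v 0 else 0)" by blast
  have "x * v 1 - v 0 \<in> J" using spec[OF x(2), of 1] by (simp add: acts_def)
  moreover have "x * v 1 \<in> J" using assms x(1) by (auto simp: two_sided_ideal_def)
  ultimately have "v 0 \<in> J" using J_diff[of "x * v 1" "x * v 1 - v 0"] by simp
  then have "v 0 \<in> span (v ` {..<0} \<union> J)" by (auto intro: span_base)
  with assms(1) show False unfolding indep_mod_def by (metis zero_less_numeral)
qed

section \<open>Perfectness bounds \<open>dim (A / J)\<close> from below\<close>

lemma span_image_lessThan_Un_J:
  fixes n :: nat
  assumes "x \<in> span (v ` {..<n} \<union> J)"
  shows "\<exists>c. x - (\<Sum>i<n. scale (c i) (v i)) \<in> J"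
  using assms
proof (induction n arbitrary: x)
  case 0
  then show ?case using subspace_J by (simp add: span_eq_iff[THEN iffD2])
next
  case (Suc n)
  then obtain k where "x - scale k (v n) \<in> span (v ` {..<n} \<union> J)"
    by (auto simp: lessThan_Suc span_insert)
  from Suc.IH[OF this] obtain c where
    c: "x - scale k (v n) - (\<Sum>i<n. scale (c i) (v i)) \<in> J" by blast
  have "(\<Sum>i<n. scale ((c(n := k)) i) (v i)) = (\<Sum>i<n. scale (c i) (v i))"
    by (intro sum.cong) auto
  with c have "x - (\<Sum>i<Suc n. scale ((c(n := k)) i) (v i)) \<in> J"
    by (simp add: algebra_simps)
  then show ?case by blast
qed

lemma two_sided_ideal_annihilator_UNIV: "two_sided_ideal (annihilator UNIV)"
  using left_ideal_annihilator[of UNIV]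
  by (auto simp: two_sided_ideal_def left_ideal_def annihilator_def mult.assoc)

lemma annihilator_UNIV_proper: "annihilator UNIV \<noteq> UNIV"
  using nontrivial_J by (auto simp: annihilator_def)

text \<open>\<open>annihilator UNIV\<close> is the kernel of the action on \<open>A / J\<close>, so
  the quotient by it embeds into the \<open>n\<close> by \<open>n\<close> matrices.\<close>

lemma codim_annihilator_le:
  assumes v: "indep_mod n v" and spanning: "span (v ` {..<n} \<union> J) = UNIV"
  shows "codim (annihilator UNIV) \<le> n * n"
proof -
  \<comment> \<open>Density provides lifts of the matrix units.\<close>
  define e where "e i j = (SOME a. \<forall>k<n. acts a (v k) (if k = j then v i else 0))" for i j
  have e: "acts (e i j) (v k) (if k = j then v i else 0)" if "k < n" for i j k
    using someI_ex[OF density[OF v, of "\<lambda>k. if k = j then v i else 0"]] that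
    by (simp add: e_def)
  define E where "E = (\<lambda>(i, j). e i j) ` ({..<n} \<times> {..<n})"
  have eE: "e i j \<in> E" if "i < n" "j < n" for i j
    using that unfolding E_def by force
  have "a \<in> span (E \<union> annihilator UNIV)" for a
  proof -
    have "\<exists>c. a * v k - (\<Sum>i<n. scale (c i) (v i)) \<in> J" for k
      using span_image_lessThan_Un_J spanning by blast
    then obtain c where c: "a * v k - (\<Sum>i<n. scale (c k i) (v i)) \<in> J" for k by metis
    \<comment> \<open>\<open>s\<close> has the same matrix as \<open>a\<close>, so
      \<open>a - s\<close> lies in the kernel.\<close>
    define s where "s = (\<Sum>i<n. \<Sum>j<n. scale (c j i) (e i j))"
    have sk: "s * v k - (\<Sum>i<n. scale (c k i) (v i)) \<in> J" if k: "k < n" for k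
    proof -
      have "s * v k - (\<Sum>i<n. \<Sum>j<n. scale (c j i) (if k = j then v i else 0)) =
          (\<Sum>i<n. \<Sum>j<n. scale (c j i) (e i j * v k - (if k = j then v i else 0)))"
        by (simp add: s_def sum_distrib_right scale_mult_left scale_right_diff_distrib sum_subtractf)
      also have "\<dots> \<in> J" using e[OF k] unfolding acts_def by (intro J_sum J_scale)
      also have "(\<Sum>i<n. \<Sum>j<n. scale (c j i) (if k = j then v i else 0)) =
          (\<Sum>i<n. scale (c k i) (v i))"
      proof (intro sum.cong refl)
        fix i
        have "(\<Sum>j<n. scale (c j i) (if k = j then v i else 0)) =
            (\<Sum>j<n. if k = j then scale (c k i) (v i) else 0)"
          by (intro sum.cong) auto
        then show "(\<Sum>j<n. scale (c j i) (if k = j then v i else 0)) = scale (c k i) (v i)"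
          using k by simp
      qed
      finally show ?thesis .
    qed
    have avs: "(a - s) * v k \<in> J" if "k < n" for k
      using J_diff[OF c[of k] sk[OF that]] by (simp add: left_diff_distrib)
    have "span (v ` {..<n} \<union> J) \<subseteq> {x. (a - s) * x \<in> J}"
      by (intro span_minimal subspace_vimage_left_mult subspace_J) (auto simp: avs J_closed)
    then have "a - s \<in> annihilator UNIV" using spanning by (auto simp: annihilator_def)
    then have "a - s \<in> span (E \<union> annihilator UNIV)" by (auto intro: span_base)
    moreover have "s \<in> span (E \<union> annihilator UNIV)"
      unfolding s_def by (intro span_sum span_scale span_base) (auto intro: eE)
    ultimately have "a - s + s \<in> span (E \<union> annihilator UNIV)" by (rule span_add)
    then show ?thesis by simp
  qed
  then have "dim UNIV \<le> dim (E \<union> annihilator UNIV)" by (intro subset_le_dim) blast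
  also have "\<dots> \<le> card E + dim (annihilator UNIV)" by (intro dim_Un_le) (simp add: E_def)
  also have "card E \<le> n * n"
    unfolding E_def using card_image_le[of "{..<n} \<times> {..<n}" "\<lambda>(i, j). e i j"]
    by (simp add: card_cartesian_product)
  finally show ?thesis by (simp add: codim_def)
qed

text \<open>If \<open>m \<le> n\<close> independent vectors already spanned \<open>A / J\<close>,
  the kernel of the action would be a proper two-sided ideal of codimension at most
  \<open>n * n\<close>. Hence another vector can be added until there are
  \<open>Suc n\<close>.\<close>

lemma exists_indep_mod:
  assumes "k_perfect (n * n)" "m \<le> Suc n"
  shows "\<exists>v. indep_mod m v"
  using assms(2)
proof (induction m)
  case 0
  show ?case by (simp add: indep_mod_def)
next
  case (Suc m)
  then obtain v where v: "indep_mod m v" by auto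
  have "codim (annihilator UNIV) > n * n"
    using assms(1) two_sided_ideal_annihilator_UNIV annihilator_UNIV_proper
    by (force simp: k_perfect_def)
  moreover have "m * m \<le> n * n" using Suc.prems by (intro mult_le_mono) auto
  ultimately have "span (v ` {..<m} \<union> J) \<noteq> UNIV" using codim_annihilator_le[OF v] by force
  then obtain w where w: "w \<notin> span (v ` {..<m} \<union> J)" by blast
  have prefix: "(v(m := w)) ` {..<i} = v ` {..<i}" if "i \<le> m" for i
    using that by (intro image_cong) auto
  have "indep_mod (Suc m) (v(m := w))"
    unfolding indep_mod_def
  proof (intro allI impI)
    fix i assume "i < Suc m"
    then have "i \<le> m" by simp
    then show "(v(m := w)) i \<notin> span ((v(m := w)) ` {..<i} \<union> J)"
      unfolding prefix[OF \<open>i \<le> m\<close>] using v w by (cases "i = m") (auto simp: indep_mod_def)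
  qed
  then show ?case by blast
qed

end

section \<open>Maximal left ideals and the conclusion\<close>

context finite_dimensional_algebra
begin

lemma k_perfect_mono: "k_perfect k \<Longrightarrow> l \<le> k \<Longrightarrow> k_perfect l"
  unfolding k_perfect_def by (meson order_trans)

text \<open>A proper left ideal of largest dimension among those containing \<open>I\<close> is
  maximal.\<close>

lemma exists_maximal_left_ideal:
  assumes "left_ideal I" "I \<noteq> UNIV"
  obtains J where "left_ideal J" "I \<subseteq> J" "J \<noteq> UNIV"
    "\<And>K. left_ideal K \<Longrightarrow> J \<subseteq> K \<Longrightarrow> K = J \<or> K = UNIV"
proof -
  let ?P = "\<lambda>J. left_ideal J \<and> I \<subseteq> J \<and> J \<noteq> UNIV"
  have "\<exists>J. ?P J \<and> (\<forall>K. ?P K \<longrightarrow> dim K \<le> dim J)"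
    by (rule ex_has_greatest_nat[of ?P I dim "Suc dimension"])
      (use assms dim_subset_UNIV in \<open>auto simp: less_Suc_eq_le\<close>)
  then obtain J where J: "?P J" and max: "\<And>K. ?P K \<Longrightarrow> dim K \<le> dim J" by blast
  have "K = J \<or> K = UNIV" if K: "left_ideal K" "J \<subseteq> K" for K
  proof (cases "K = UNIV")
    case False
    then have "dim K \<le> dim J" using K J by (intro max) auto
    then have "J = K" using K J by (intro subspace_dim_equal) (auto simp: left_ideal_def)
    then show ?thesis by simp
  qed simp
  with J that show ?thesis by blast
qed

text \<open>
  If \<open>A A \<subseteq> J\<close>, every subspace containing \<open>J\<close> is a two-sided ideal, so maximality forces \<open>J\<close> to
  have codimension one.
\<close>
lemma mult_not_in_maximal_left_ideal:
  assumes "k_perfect 1" and J: "left_ideal J" "J \<noteq> UNIV"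
    and max: "\<And>K. left_ideal K \<Longrightarrow> J \<subseteq> K \<Longrightarrow> K = J \<or> K = UNIV"
  shows "\<exists>a b. a * b \<notin> J"
proof (rule ccontr)
  assume "\<not> ?thesis"
  then have AA: "a * b \<in> J" for a b by blast
  have subJ: "subspace J" using J by (simp add: left_ideal_def)
  obtain v where v: "v \<notin> J" using J by blast
  have J_sub: "J \<subseteq> span (insert v J)" by (auto intro: span_base)
  then have "left_ideal (span (insert v J))" using AA by (auto simp: left_ideal_def)
  from max[OF this J_sub] have "span (insert v J) = UNIV"
    using v span_base[of v "insert v J"] by auto
  then have "dim UNIV = dim (insert v J)" by (metis dim_span)
  then have "codim J \<le> 1" by (simp add: codim_def dim_insert)
  moreover have "two_sided_ideal J" using AA subJ by (simp add: two_sided_ideal_def)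
  ultimately show False using assms(1) J by (auto simp: k_perfect_def)
qed

end

theorem theorem1p2:
  fixes scale :: "'k::alg_closed_field \<Rightarrow> 'a::ring \<Rightarrow> 'a"
    and Basis :: "'a set"
  assumes "finite_dimensional_algebra scale Basis"
    and "finite_dimensional_algebra.k_perfect scale 4 \<or>
         (finite_dimensional_algebra.k_perfect scale 1 \<and> CHAR('k) \<noteq> 2)"
  shows "associative_algebra.lie_perfect scale (associative_algebra.derived scale) \<and>
         (UNIV :: 'a set) =
           associative_algebra.assoc_product scale
             (associative_algebra.derived scale) (associative_algebra.derived scale)
           + associative_algebra.derived scale"
proof -
  interpret finite_dimensional_algebra scale Basis by (rule assms(1))
  have perfect: "k_perfect 1" using assms(2) k_perfect_mono[of 4 1] by auto
  let ?D = "lie_product derived derived"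
  show ?thesis
  proof (rule lie_perfect_derived_if_no_ideal, rule ccontr)
    fix I assume I: "two_sided_ideal I" "lie_product ?D ?D \<subseteq> I" "I \<noteq> UNIV"
    then have "left_ideal I" by (simp add: two_sided_ideal_def left_ideal_def)
    then obtain J where J: "left_ideal J" "I \<subseteq> J" "J \<noteq> UNIV"
      "\<And>K. left_ideal K \<Longrightarrow> J \<subseteq> K \<Longrightarrow> K = J \<or> K = UNIV"
      using exists_maximal_left_ideal I by metis
    interpret simple_quotient_module scale Basis J
      using J mult_not_in_maximal_left_ideal[OF perfect J(1,3,4)] by unfold_locales auto
    show False
    proof (cases "k_perfect 4")
      case True
      \<comment> \<open>Since \<open>4 = 2 * 2\<close>, the codimension bound yields three
        independent vectors.\<close>
      then obtain v where v: "indep_mod 3 v" using exists_indep_mod[of 2 3] by auto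
      have "contains_root_vectors v (lie_product ?D ?D)"
        \<comment> \<open>\<open>lie_product ?D ?D\<close> arises from \<open>UNIV\<close> by three
          successive Lie products, so persistence is applied three times.\<close>
        unfolding derived_def
        by (intro contains_root_vectors_lie_product contains_root_vectors_UNIV v)
      with not_contains_root_vectors[OF v I(1) J(2) I(2)] show False by contradiction
    next
      case False
      then have "\<not> CHAR('k) dvd 2"
        using assms(2) by (metis CHAR_not_1' One_nat_def prime_nat_iff two_is_prime_nat)
      then have two: "(2::'k) \<noteq> 0" using of_nat_eq_0_iff_char_dvd[where 'a = 'k, of 2] by simp
      \<comment> \<open>Here \<open>1 = 1 * 1\<close> gives only two vectors, enough for
        \<open>sl_2\<close> because \<open>2\<close> is nonzero.\<close>
      obtain v where v: "indep_mod 2 v" using exists_indep_mod[of 1 2] perfect by auto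
      have "contains_sl2 v (lie_product ?D ?D)"
        unfolding derived_def by (intro contains_sl2_lie_product contains_sl2_UNIV two v)
      with not_contains_sl2[OF v I(1) J(2) I(2)] show False by contradiction
    qed
  qed
qed

end
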